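(* Let $\mathscr{A}$ be an abelian category with enough projective objects and let $\mathscr{T}$ be a support $\tau$-tilting subcategory of $\mathscr{A}$. Then $\mathrm{Fac}(\mathscr{T})$ is a functorially finite torsion class in $\mathscr{A}$.
   Context: Subcategories are full and closed under isomorphisms. $\mathrm{Fac}(\mathscr{X})$ is the full subcategory of all quotients of objects of $\mathscr{X}$ (for a single object $T$, quotients of finite direct sums of copies of $T$). A left $\mathscr{X}$-approximation of $A$ is a morphism $f:A\to X$ with $X\in\mathscr{X}$ such that every morphism $A\to X'$ with $X'\in\mathscr{X}$ factors through $f$; right approximations are dual. $\mathscr{X}$ is contravariantly (resp. covariantly) finite if every object of $\mathscr{A}$ has a right (resp. left) $\mathscr{X}$-approximation, and functorially finite if both. Support $\tau$-tilting subcategory: an additive full subcategory $\mathscr{T}$ (closed under finite direct sums and direct summands), contravariantly finite in $\mathscr{A}$, such that (i) $\mathrm{Ext}^1_{\mathscr{A}}(T_1,\mathrm{Fac}(T_2))=0$ for all $T_1,T_2\in\mathscr{T}$; (ii) for every projective $P$ in $\mathscr{A}$ there is an exact sequence $P\xrightarrow{f}T^0\to T^1\to0$ with $T^0,T^1\in\mathscr{T}$ and $f$ a left $\mathscr{T}$-approximation of $P$. A torsion class is a full subcategory $\mathscr{D}$ for which there is a full subcategory $\mathscr{F}$ such that $(\mathscr{D},\mathscr{F})$ is a torsion pair: $\mathrm{Hom}_{\mathscr{A}}(\mathscr{D},\mathscr{F})=0$ and every $A\in\mathscr{A}$ has a short exact sequence $0\to tA\to A\to fA\to0$ with $tA\in\mathscr{D}$,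 $fA\in\mathscr{F}$. *)

theory Defs
  imports "HOL-Algebra.Group"
begin

section \<open>Abelian categories\<close>

text \<open>
  Objects and morphisms are elements of carrier sets inside two ambient types.
  \<open>g \<cdot> f\<close> is "first f, then g". Only values on composable (for \<open>Add\<close>: parallel) morphisms matter.
\<close>

record ('o, 'm) precat =
  Obj :: "'o set"
  Mor :: "'m set"
  src :: "'m \<Rightarrow> 'o"
  tgt :: "'m \<Rightarrow> 'o"
  ident :: "'o \<Rightarrow> 'm"
  Comp :: "'m \<Rightarrow> 'm \<Rightarrow> 'm"  (infixl \<open>\<cdot>\<index>\<close> 70)
  Add :: "'m \<Rightarrow> 'm \<Rightarrow> 'm"
  Zero :: "'o \<Rightarrow> 'o \<Rightarrow> 'm"

definition Hom :: "('o, 'm, 'x) precat_scheme \<Rightarrow> 'o \<Rightarrow> 'o \<Rightarrow> 'm set" where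
  "Hom C A B = {f \<in> Mor C. src C f = A \<and> tgt C f = B}"

definition Hom_group :: "('o, 'm, 'x) precat_scheme \<Rightarrow> 'o \<Rightarrow> 'o \<Rightarrow> 'm monoid" where
  "Hom_group C A B = \<lparr>carrier = Hom C A B, mult = Add C, one = Zero C A B\<rparr>"

locale category =
  fixes C :: "('o, 'm, 'x) precat_scheme" (structure)
  assumes src_Obj: "f \<in> Mor C \<Longrightarrow> src C f \<in> Obj C"
    and tgt_Obj: "f \<in> Mor C \<Longrightarrow> tgt C f \<in> Obj C"
    and ident_Hom: "A \<in> Obj C \<Longrightarrow> ident C A \<in> Hom C A A"
    and Comp_Hom: "\<lbrakk>f \<in> Hom C A B; g \<in> Hom C B D\<rbrakk> \<Longrightarrow> g \<cdot> f \<in> Hom C A D"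
    and Comp_ident: "f \<in> Hom C A B \<Longrightarrow> f \<cdot> ident C A = f"
    and ident_Comp: "f \<in> Hom C A B \<Longrightarrow> ident C B \<cdot> f = f"
    and Comp_assoc: "\<lbrakk>f \<in> Hom C A B; g \<in> Hom C B D; h \<in> Hom C D E\<rbrakk>
      \<Longrightarrow> h \<cdot> (g \<cdot> f) = (h \<cdot> g) \<cdot> f"

locale preadditive_category = category +
  assumes Hom_comm_group: "\<lbrakk>A \<in> Obj C; B \<in> Obj C\<rbrakk> \<Longrightarrow> comm_group (Hom_group C A B)"
    and Comp_Add: "\<lbrakk>f \<in> Hom C A B; f' \<in> Hom C A B; g \<in> Hom C B D\<rbrakk>
      \<Longrightarrow> g \<cdot> Add C f f' = Add C (g \<cdot> f) (g \<cdot> f')"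
    and Add_Comp: "\<lbrakk>f \<in> Hom C A B; g \<in> Hom C B D; g' \<in> Hom C B D\<rbrakk>
      \<Longrightarrow> Add C g g' \<cdot> f = Add C (g \<cdot> f) (g' \<cdot> f)"

definition mono_mor :: "('o, 'm, 'x) precat_scheme \<Rightarrow> 'm \<Rightarrow> bool" where
  "mono_mor C f \<longleftrightarrow> f \<in> Mor C \<and>
    (\<forall>A\<in>Obj C. \<forall>u\<in>Hom C A (src C f). \<forall>v\<in>Hom C A (src C f). f \<cdot>\<^bsub>C\<^esub> u = f \<cdot>\<^bsub>C\<^esub> v \<longrightarrow> u = v)"

definition epi_mor :: "('o, 'm, 'x) precat_scheme \<Rightarrow> 'm \<Rightarrow> bool" where
  "epi_mor C f \<longleftrightarrow> f \<in> Mor C \<and>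
    (\<forall>B\<in>Obj C. \<forall>u\<in>Hom C (tgt C f) B. \<forall>v\<in>Hom C (tgt C f) B. u \<cdot>\<^bsub>C\<^esub> f = v \<cdot>\<^bsub>C\<^esub> f \<longrightarrow> u = v)"

definition iso_mor :: "('o, 'm, 'x) precat_scheme \<Rightarrow> 'm \<Rightarrow> bool" where
  "iso_mor C f \<longleftrightarrow> f \<in> Mor C \<and>
    (\<exists>g\<in>Hom C (tgt C f) (src C f). g \<cdot>\<^bsub>C\<^esub> f = ident C (src C f) \<and> f \<cdot>\<^bsub>C\<^esub> g = ident C (tgt C f))"

definition zero_obj :: "('o, 'm, 'x) precat_scheme \<Rightarrow> 'o \<Rightarrow> bool" where
  "zero_obj C Z \<longleftrightarrow> Z \<in> Obj C \<and>
    (\<forall>A\<in>Obj C. (\<exists>!f. f \<in> Hom C A Z) \<and> (\<exists>!f. f \<in> Hom C Z A))"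

text \<open>
  \<open>M\<close> is the direct sum of \<open>D 0, \<dots>, D (n - 1)\<close>, as a coproduct with injections \<open>\<iota> i\<close>;
  \<open>n = 0\<close> gives an initial object, which in a preadditive category is a zero object.
\<close>

definition is_direct_sum ::
    "('o, 'm, 'x) precat_scheme \<Rightarrow> nat \<Rightarrow> (nat \<Rightarrow> 'o) \<Rightarrow> 'o \<Rightarrow> (nat \<Rightarrow> 'm) \<Rightarrow> bool" where
  "is_direct_sum C n D M \<iota> \<longleftrightarrow>
    M \<in> Obj C \<and> (\<forall>i<n. D i \<in> Obj C \<and> \<iota> i \<in> Hom C (D i) M) \<and>
    (\<forall>B\<in>Obj C. \<forall>g. (\<forall>i<n. g i \<in> Hom C (D i) B) \<longrightarrow>
      (\<exists>!h. h \<in> Hom C M B \<and> (\<forall>i<n. h \<cdot>\<^bsub>C\<^esub> \<iota> i = g i)))"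

definition is_kernel :: "('o, 'm, 'x) precat_scheme \<Rightarrow> 'm \<Rightarrow> 'm \<Rightarrow> bool" where
  "is_kernel C k f \<longleftrightarrow> k \<in> Mor C \<and> f \<in> Mor C \<and> tgt C k = src C f \<and>
    f \<cdot>\<^bsub>C\<^esub> k = Zero C (src C k) (tgt C f) \<and>
    (\<forall>A\<in>Obj C. \<forall>h\<in>Hom C A (src C f). f \<cdot>\<^bsub>C\<^esub> h = Zero C A (tgt C f) \<longrightarrow>
      (\<exists>!u. u \<in> Hom C A (src C k) \<and> k \<cdot>\<^bsub>C\<^esub> u = h))"

definition is_cokernel :: "('o, 'm, 'x) precat_scheme \<Rightarrow> 'm \<Rightarrow> 'm \<Rightarrow> bool" where
  "is_cokernel C c f \<longleftrightarrow> c \<in> Mor C \<and> f \<in> Mor C \<and> src C c = tgt C f \<and>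
    c \<cdot>\<^bsub>C\<^esub> f = Zero C (src C f) (tgt C c) \<and>
    (\<forall>B\<in>Obj C. \<forall>h\<in>Hom C (tgt C f) B. h \<cdot>\<^bsub>C\<^esub> f = Zero C (src C f) B \<longrightarrow>
      (\<exists>!u. u \<in> Hom C (tgt C c) B \<and> u \<cdot>\<^bsub>C\<^esub> c = h))"

locale additive_category = preadditive_category +
  assumes ex_zero_obj: "\<exists>Z. zero_obj C Z"
    and ex_direct_sum: "(\<forall>i<n. D i \<in> Obj C) \<Longrightarrow> \<exists>M \<iota>. is_direct_sum C n D M \<iota>"

locale abelian_category = additive_category +
  assumes ex_kernel: "f \<in> Mor C \<Longrightarrow> \<exists>k. is_kernel C k f"
    and ex_cokernel: "f \<in> Mor C \<Longrightarrow> \<exists>c. is_cokernel C c f"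
    and mono_normal: "mono_mor C f \<Longrightarrow> \<exists>g. is_kernel C f g"
    and epi_normal: "epi_mor C f \<Longrightarrow> \<exists>g. is_cokernel C f g"

section \<open>Exactness, projectives and \<open>Ext\<close>\<close>

definition is_image :: "('o, 'm, 'x) precat_scheme \<Rightarrow> 'm \<Rightarrow> 'm \<Rightarrow> bool" where
  "is_image C m f \<longleftrightarrow> (\<exists>c. is_cokernel C c f \<and> is_kernel C m c)"

definition exact_at :: "('o, 'm, 'x) precat_scheme \<Rightarrow> 'm \<Rightarrow> 'm \<Rightarrow> bool" where
  "exact_at C f g \<longleftrightarrow> (\<exists>m. is_image C m f \<and> is_kernel C m g)"

text \<open>
  The morphisms are listed in the order in which they are drawn; \<^const>\<open>exact_at\<close> includes
  composability of neighbours.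
\<close>

definition exact_seq :: "('o, 'm, 'x) precat_scheme \<Rightarrow> 'm list \<Rightarrow> bool" where
  "exact_seq C fs \<longleftrightarrow> successively (exact_at C) fs"

definition short_exact :: "('o, 'm, 'x) precat_scheme \<Rightarrow> 'm \<Rightarrow> 'm \<Rightarrow> bool" where
  "short_exact C i p \<longleftrightarrow>
    (\<exists>Z. zero_obj C Z \<and> exact_seq C [Zero C Z (src C i), i, p, Zero C (tgt C p) Z])"

definition right_exact :: "('o, 'm, 'x) precat_scheme \<Rightarrow> 'm \<Rightarrow> 'm \<Rightarrow> bool" where
  "right_exact C f g \<longleftrightarrow>
    (\<exists>Z. zero_obj C Z \<and> exact_seq C [f, g, Zero C (tgt C g) Z])"

definition projective :: "('o, 'm, 'x) precat_scheme \<Rightarrow> 'o \<Rightarrow> bool" where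
  "projective C P \<longleftrightarrow> P \<in> Obj C \<and>
    (\<forall>p. epi_mor C p \<longrightarrow> (\<forall>f\<in>Hom C P (tgt C p). \<exists>g\<in>Hom C P (src C p). p \<cdot>\<^bsub>C\<^esub> g = f))"

definition enough_projectives :: "('o, 'm, 'x) precat_scheme \<Rightarrow> bool" where
  "enough_projectives C \<longleftrightarrow>
    (\<forall>A\<in>Obj C. \<exists>P p. projective C P \<and> p \<in> Hom C P A \<and> epi_mor C p)"

text \<open>
  Yoneda's \<open>Ext\<^sup>1(X, Y)\<close>: short exact sequences \<open>0 \<rightarrow> Y \<rightarrow> E \<rightarrow> X \<rightarrow> 0\<close>, represented by the pair of
  their two middle morphisms, modulo isomorphisms that are the identity on \<open>X\<close> and \<open>Y\<close>.
  The Baer sum is not needed: \<open>Ext\<^sup>1(X, Y)\<close> is zero as a group iff it has exactly one element.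
\<close>

definition extensions :: "('o, 'm, 'x) precat_scheme \<Rightarrow> 'o \<Rightarrow> 'o \<Rightarrow> ('m \<times> 'm) set" where
  "extensions C X Y = {(i, p). short_exact C i p \<and> src C i = Y \<and> tgt C p = X}"

definition ext_equiv ::
    "('o, 'm, 'x) precat_scheme \<Rightarrow> 'o \<Rightarrow> 'o \<Rightarrow> (('m \<times> 'm) \<times> ('m \<times> 'm)) set" where
  "ext_equiv C X Y = {((i, p), (i', p')).
    (i, p) \<in> extensions C X Y \<and> (i', p') \<in> extensions C X Y \<and>
    (\<exists>h\<in>Hom C (tgt C i) (tgt C i'). iso_mor C h \<and> h \<cdot>\<^bsub>C\<^esub> i = i' \<and> p' \<cdot>\<^bsub>C\<^esub> h = p)}"

definition Ext1 :: "('o, 'm, 'x) precat_scheme \<Rightarrow> 'o \<Rightarrow> 'o \<Rightarrow> ('m \<times> 'm) set set" where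
  "Ext1 C X Y = extensions C X Y // ext_equiv C X Y"

definition Ext1_zero :: "('o, 'm, 'x) precat_scheme \<Rightarrow> 'o \<Rightarrow> 'o \<Rightarrow> bool" where
  "Ext1_zero C X Y \<longleftrightarrow> is_singleton (Ext1 C X Y)"

section \<open>Subcategories, approximations and torsion classes\<close>

text \<open>A full subcategory closed under isomorphisms is given by its class of objects.\<close>

definition full_subcat :: "('o, 'm, 'x) precat_scheme \<Rightarrow> 'o set \<Rightarrow> bool" where
  "full_subcat C S \<longleftrightarrow> S \<subseteq> Obj C \<and>
    (\<forall>f. iso_mor C f \<longrightarrow> src C f \<in> S \<longrightarrow> tgt C f \<in> S)"

text \<open>
  Closure under finite direct sums includes the empty one, so zero objects belong to \<open>S\<close>.
\<close>

definition additive_subcat :: "('o, 'm, 'x) precat_scheme \<Rightarrow> 'o set \<Rightarrow> bool" where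
  "additive_subcat C S \<longleftrightarrow> full_subcat C S \<and>
    (\<forall>n D M \<iota>. is_direct_sum C n D M \<iota> \<longrightarrow> (\<forall>i<n. D i \<in> S) \<longrightarrow> M \<in> S) \<and>
    (\<forall>n D M \<iota>. is_direct_sum C n D M \<iota> \<longrightarrow> M \<in> S \<longrightarrow> (\<forall>i<n. D i \<in> S))"

definition Fac :: "('o, 'm, 'x) precat_scheme \<Rightarrow> 'o set \<Rightarrow> 'o set" where
  "Fac C S = {B \<in> Obj C. \<exists>A\<in>S. \<exists>p\<in>Hom C A B. epi_mor C p}"

definition Fac_obj :: "('o, 'm, 'x) precat_scheme \<Rightarrow> 'o \<Rightarrow> 'o set" where
  "Fac_obj C T = Fac C {M. \<exists>n \<iota>. is_direct_sum C n (\<lambda>_. T) M \<iota>}"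

definition left_approx :: "('o, 'm, 'x) precat_scheme \<Rightarrow> 'o set \<Rightarrow> 'o \<Rightarrow> 'm \<Rightarrow> bool" where
  "left_approx C S A f \<longleftrightarrow> f \<in> Mor C \<and> src C f = A \<and> tgt C f \<in> S \<and>
    (\<forall>X\<in>S. \<forall>g\<in>Hom C A X. \<exists>h\<in>Hom C (tgt C f) X. h \<cdot>\<^bsub>C\<^esub> f = g)"

definition right_approx :: "('o, 'm, 'x) precat_scheme \<Rightarrow> 'o set \<Rightarrow> 'o \<Rightarrow> 'm \<Rightarrow> bool" where
  "right_approx C S A f \<longleftrightarrow> f \<in> Mor C \<and> tgt C f = A \<and> src C f \<in> S \<and>
    (\<forall>X\<in>S. \<forall>g\<in>Hom C X A. \<exists>h\<in>Hom C X (src C f). f \<cdot>\<^bsub>C\<^esub> h = g)"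

definition contravariantly_finite :: "('o, 'm, 'x) precat_scheme \<Rightarrow> 'o set \<Rightarrow> bool" where
  "contravariantly_finite C S \<longleftrightarrow> (\<forall>A\<in>Obj C. \<exists>f. right_approx C S A f)"

definition covariantly_finite :: "('o, 'm, 'x) precat_scheme \<Rightarrow> 'o set \<Rightarrow> bool" where
  "covariantly_finite C S \<longleftrightarrow> (\<forall>A\<in>Obj C. \<exists>f. left_approx C S A f)"

definition functorially_finite :: "('o, 'm, 'x) precat_scheme \<Rightarrow> 'o set \<Rightarrow> bool" where
  "functorially_finite C S \<longleftrightarrow> contravariantly_finite C S \<and> covariantly_finite C S"

definition torsion_pair :: "('o, 'm, 'x) precat_scheme \<Rightarrow> 'o set \<Rightarrow> 'o set \<Rightarrow> bool" where
  "torsion_pair C \<D> \<F> \<longleftrightarrow> full_subcat C \<D> \<and> full_subcat C \<F> \<and>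
    (\<forall>D\<in>\<D>. \<forall>F\<in>\<F>. Hom C D F = {Zero C D F}) \<and>
    (\<forall>A\<in>Obj C. \<exists>i p. short_exact C i p \<and> tgt C i = A \<and> src C i \<in> \<D> \<and> tgt C p \<in> \<F>)"

definition torsion_class :: "('o, 'm, 'x) precat_scheme \<Rightarrow> 'o set \<Rightarrow> bool" where
  "torsion_class C \<D> \<longleftrightarrow> (\<exists>\<F>. torsion_pair C \<D> \<F>)"

definition support_tau_tilting :: "('o, 'm, 'x) precat_scheme \<Rightarrow> 'o set \<Rightarrow> bool" where
  "support_tau_tilting C \<T> \<longleftrightarrow>
    additive_subcat C \<T> \<and> contravariantly_finite C \<T> \<and>
    (\<forall>T\<^sub>1\<in>\<T>. \<forall>T\<^sub>2\<in>\<T>. \<forall>Y\<in>Fac_obj C T\<^sub>2. Ext1_zero C T\<^sub>1 Y) \<and>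
    (\<forall>P. projective C P \<longrightarrow>
      (\<exists>f g. right_exact C f g \<and> left_approx C \<T> P f \<and> tgt C g \<in> \<T>))"

end

theory Submission imports Defs begin

text \<open>
  Write \<open>Fac \<T>\<close> for the quotients of objects of \<open>\<T>\<close>. The subobject \<open>tA\<close> of an object \<open>A\<close> is taken to
  be the image of a right \<open>\<T>\<close>-approximation of \<open>A\<close>. It is a quotient of an object of \<open>\<T>\<close>, and every
  morphism from \<open>Fac \<T>\<close> to \<open>A\<close> has its image inside \<open>tA\<close>, because this can be tested after
  precomposing with an epimorphism from an object of \<open>\<T>\<close>. So \<open>tA \<rightarrow> A\<close> is a right
  \<open>Fac \<T>\<close>-approximation (lemma \<open>right_approx_image\<close>).

  For the torsion pair it remains to see that no nonzero morphism leads from \<open>Fac \<T>\<close> to \<open>A/tA\<close>; again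
  it suffices to start in \<open>T \<in> \<T>\<close>. Pull the extension \<open>0 \<rightarrow> tA \<rightarrow> A \<rightarrow> A/tA \<rightarrow> 0\<close> back along
  \<open>T \<rightarrow> A/tA\<close>. As \<open>Ext\<^sup>1(T, tA) = 0\<close>, the result splits, so the morphism lifts to \<open>T \<rightarrow> A\<close>
  (lemma \<open>Ext1_zero_lift\<close>). The lift lands in \<open>tA\<close>, hence the morphism is zero.

  For a left approximation of \<open>A\<close>, choose an epimorphism \<open>P \<rightarrow> A\<close> with \<open>P\<close> projective and push a left
  \<open>\<T>\<close>-approximation \<open>P \<rightarrow> T\<close> out along it (lemma \<open>covariantly_finite_Fac\<close>). The pushout \<open>B\<close> is a
  quotient of \<open>T\<close>. A morphism \<open>A \<rightarrow> X\<close> with \<open>X\<close> a quotient of \<open>V \<in> \<T>\<close> yields \<open>P \<rightarrow> A \<rightarrow> X\<close>, which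
  lifts to \<open>V\<close> by projectivity and then extends along \<open>P \<rightarrow> T\<close>; the pushout property turns the
  resulting \<open>T \<rightarrow> V \<rightarrow> X\<close> and \<open>A \<rightarrow> X\<close> into \<open>B \<rightarrow> X\<close>.
\<close>

section \<open>Hom groups, monomorphisms and epimorphisms\<close>

lemma Hom_src_tgt: "f \<in> Hom C A B \<Longrightarrow> src C f = A \<and> tgt C f = B \<and> f \<in> Mor C"
  by (simp add: Hom_def)

context category
begin

lemma Hom_Obj:
  assumes "f \<in> Hom C A B"
  shows "A \<in> Obj C" "B \<in> Obj C"
  using assms src_Obj tgt_Obj by (auto simp: Hom_def)

lemma iso_ident: "A \<in> Obj C \<Longrightarrow> iso_mor C (ident C A)"
  using ident_Hom[of A] Comp_ident[of "ident C A" A A]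
  unfolding iso_mor_def by (auto simp: Hom_def)

lemma epi_cancel:
  assumes "epi_mor C f" "f \<in> Hom C A B" "u \<in> Hom C B D" "v \<in> Hom C B D" "u \<cdot> f = v \<cdot> f"
  shows "u = v"
  using assms Hom_Obj(2)[of u B D] unfolding epi_mor_def by (auto simp: Hom_def)

lemma mono_cancel:
  assumes "mono_mor C f" "f \<in> Hom C A B" "u \<in> Hom C D A" "v \<in> Hom C D A" "f \<cdot> u = f \<cdot> v"
  shows "u = v"
  using assms Hom_Obj(1)[of u D A] unfolding mono_mor_def by (auto simp: Hom_def)

lemma epi_Comp:
  assumes f: "f \<in> Hom C A B" and g: "g \<in> Hom C B D" and ef: "epi_mor C f" and eg: "epi_mor C g"
  shows "epi_mor C (g \<cdot> f)"
proof -
  have gf: "g \<cdot> f \<in> Hom C A D" using Comp_Hom[OF f g] .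
  have "u = v" if "u \<in> Hom C D E" "v \<in> Hom C D E" "u \<cdot> (g \<cdot> f) = v \<cdot> (g \<cdot> f)" for u v E
  proof -
    have "(u \<cdot> g) \<cdot> f = (v \<cdot> g) \<cdot> f"
      using that Comp_assoc[OF f g] by metis
    then have "u \<cdot> g = v \<cdot> g"
      using epi_cancel[OF ef f] that Comp_Hom[OF g] by blast
    then show ?thesis using epi_cancel[OF eg g] that by blast
  qed
  then show ?thesis using gf Hom_src_tgt[OF gf] unfolding epi_mor_def by auto
qed

lemma iso_epi:
  assumes "iso_mor C f"
  shows "epi_mor C f"
proof -
  obtain g where f: "f \<in> Hom C (src C f) (tgt C f)" and g: "g \<in> Hom C (tgt C f) (src C f)"
    and fg: "f \<cdot> g = ident C (tgt C f)"
    using assms unfolding iso_mor_def by (auto simp: Hom_def)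
  have "u = v" if u: "u \<in> Hom C (tgt C f) B" and v: "v \<in> Hom C (tgt C f) B" and e: "u \<cdot> f = v \<cdot> f"
    for u v B
    using Comp_assoc[OF g f u] Comp_assoc[OF g f v] e fg Comp_ident[OF u] Comp_ident[OF v]
    by simp
  then show ?thesis using assms unfolding epi_mor_def iso_mor_def by auto
qed

lemma full_subcat_Fac: "full_subcat C (Fac C S)"
proof -
  have "tgt C f \<in> Fac C S" if f: "iso_mor C f" and X: "src C f \<in> Fac C S" for f
  proof -
    obtain A p where A: "A \<in> S" and p: "p \<in> Hom C A (src C f)" "epi_mor C p"
      using X unfolding Fac_def by blast
    have "f \<in> Hom C (src C f) (tgt C f)"
      using f unfolding iso_mor_def by (simp add: Hom_def)
    then show ?thesis
      using A epi_Comp[OF p(1) _ p(2) iso_epi[OF f]] Comp_Hom[OF p(1)] Hom_Obj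
      unfolding Fac_def by blast
  qed
  then show ?thesis unfolding full_subcat_def Fac_def by auto
qed

end

context preadditive_category
begin

lemma Zero_Hom: "A \<in> Obj C \<Longrightarrow> B \<in> Obj C \<Longrightarrow> Zero C A B \<in> Hom C A B"
  using group.is_monoid[OF comm_group.axioms(2)[OF Hom_comm_group]] monoid.one_closed
  by (fastforce simp: Hom_group_def)

lemma Add_Hom:
  assumes "f \<in> Hom C A B" "g \<in> Hom C A B"
  shows "Add C f g \<in> Hom C A B"
proof -
  interpret H: comm_group "Hom_group C A B" using Hom_comm_group Hom_Obj[OF assms(1)] by blast
  show ?thesis using H.m_closed[of f g] assms by (simp add: Hom_group_def)
qed

lemma Add_Zero:
  assumes "f \<in> Hom C A B"
  shows "Add C f (Zero C A B) = f" "Add C (Zero C A B) f = f"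
proof -
  interpret H: comm_group "Hom_group C A B" using Hom_comm_group Hom_Obj[OF assms(1)] by blast
  show "Add C f (Zero C A B) = f" "Add C (Zero C A B) f = f"
    using H.r_one[of f] H.l_one[of f] assms by (simp_all add: Hom_group_def)
qed

lemma Add_left_cancel:
  assumes "f \<in> Hom C A B" "g \<in> Hom C A B" "h \<in> Hom C A B" "Add C f g = Add C f h"
  shows "g = h"
proof -
  interpret H: comm_group "Hom_group C A B" using Hom_comm_group Hom_Obj[OF assms(1)] by blast
  show ?thesis using H.Units_l_cancel[of f g h] H.Units_eq assms by (simp add: Hom_group_def)
qed

lemma Add_right_cancel:
  assumes "f \<in> Hom C A B" "g \<in> Hom C A B" "h \<in> Hom C A B" "Add C g f = Add C h f"
  shows "g = h"
proof -
  interpret H: comm_group "Hom_group C A B" using Hom_comm_group Hom_Obj[OF assms(1)] by blast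
  show ?thesis using H.right_cancel[of f g h] assms by (simp add: Hom_group_def)
qed

lemma ex_difference:
  assumes "f \<in> Hom C A B" "g \<in> Hom C A B"
  obtains d where "d \<in> Hom C A B" "Add C f d = g"
proof -
  interpret H: comm_group "Hom_group C A B" using Hom_comm_group Hom_Obj[OF assms(1)] by blast
  let ?G = "Hom_group C A B"
  let ?d = "inv\<^bsub>?G\<^esub> f \<otimes>\<^bsub>?G\<^esub> g"
  have c: "f \<in> carrier ?G" "g \<in> carrier ?G" using assms by (simp_all add: Hom_group_def)
  then have "f \<otimes>\<^bsub>?G\<^esub> ?d = g" "?d \<in> carrier ?G"
    by (simp_all add: H.m_assoc[symmetric])
  then show thesis using that[of ?d] by (simp add: Hom_group_def)
qed

lemma Comp_Zero:
  assumes "f \<in> Hom C A B" "D \<in> Obj C"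
  shows "f \<cdot> Zero C D A = Zero C D B"
proof -
  have z: "Zero C D A \<in> Hom C D A" using Zero_Hom assms Hom_Obj by blast
  have fz: "f \<cdot> Zero C D A \<in> Hom C D B" using Comp_Hom z assms(1) by blast
  have zB: "Zero C D B \<in> Hom C D B" using Zero_Hom assms Hom_Obj by blast
  have "Add C (f \<cdot> Zero C D A) (f \<cdot> Zero C D A) = Add C (f \<cdot> Zero C D A) (Zero C D B)"
    using Comp_Add[OF z z assms(1)] Add_Zero[OF z] Add_Zero[OF fz] by simp
  then show ?thesis using Add_left_cancel[OF fz fz zB] by blast
qed

lemma Zero_Comp:
  assumes "f \<in> Hom C A B" "D \<in> Obj C"
  shows "Zero C B D \<cdot> f = Zero C A D"
proof -
  have z: "Zero C B D \<in> Hom C B D" using Zero_Hom assms Hom_Obj by blast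
  have fz: "Zero C B D \<cdot> f \<in> Hom C A D" using Comp_Hom z assms(1) by blast
  have zB: "Zero C A D \<in> Hom C A D" using Zero_Hom assms Hom_Obj by blast
  have "Add C (Zero C B D \<cdot> f) (Zero C B D \<cdot> f) = Add C (Zero C B D \<cdot> f) (Zero C A D)"
    using Add_Comp[OF assms(1) z z] Add_Zero[OF z] Add_Zero[OF fz] by simp
  then show ?thesis using Add_left_cancel[OF fz fz zB] by blast
qed

lemma epi_cancel_Zero:
  assumes "epi_mor C f" "f \<in> Hom C A B" "u \<in> Hom C B D" "u \<cdot> f = Zero C A D"
  shows "u = Zero C B D"
  using epi_cancel[OF assms(1-3)] Zero_Hom Hom_Obj assms Zero_Comp[OF assms(2)] by metis

lemma epiI:
  assumes f: "f \<in> Hom C A B"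
    and z: "\<And>D u. u \<in> Hom C B D \<Longrightarrow> u \<cdot> f = Zero C A D \<Longrightarrow> u = Zero C B D"
  shows "epi_mor C f"
proof -
  have "u = v" if u: "u \<in> Hom C B D" and v: "v \<in> Hom C B D" and e: "u \<cdot> f = v \<cdot> f" for u v D
  proof -
    obtain d where d: "d \<in> Hom C B D" "Add C u d = v" using ex_difference[OF u v] .
    have uf: "u \<cdot> f \<in> Hom C A D" and df: "d \<cdot> f \<in> Hom C A D"
      using Comp_Hom f u d by blast+
    have zz: "Zero C A D \<in> Hom C A D" using Zero_Hom Hom_Obj[OF uf] by blast
    have "Add C (u \<cdot> f) (d \<cdot> f) = Add C (u \<cdot> f) (Zero C A D)"
      using Add_Comp[OF f u d(1)] d(2) e Add_Zero[OF uf] by simp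
    then have "d \<cdot> f = Zero C A D" using Add_left_cancel[OF uf df zz] by blast
    then show "u = v" using z[OF d(1)] Add_Zero[OF u] d(2) by simp
  qed
  then show ?thesis using f unfolding epi_mor_def by (auto simp: Hom_def)
qed

lemma kernel_Hom:
  assumes "is_kernel C k f" "f \<in> Hom C A B"
  shows "k \<in> Hom C (src C k) A"
  using assms unfolding is_kernel_def Hom_def by auto

lemma cokernel_Hom:
  assumes "is_cokernel C c f" "f \<in> Hom C A B"
  shows "c \<in> Hom C B (tgt C c)"
  using assms unfolding is_cokernel_def Hom_def by auto

lemma kernelI:
  assumes "k \<in> Hom C K A" "f \<in> Hom C A B" "f \<cdot> k = Zero C K B"
    and "\<And>X h. h \<in> Hom C X A \<Longrightarrow> f \<cdot> h = Zero C X B \<Longrightarrow> \<exists>!u. u \<in> Hom C X K \<and> k \<cdot> u = h"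
  shows "is_kernel C k f"
  using assms Hom_src_tgt[OF assms(1)] Hom_src_tgt[OF assms(2)] unfolding is_kernel_def by auto

lemma cokernelI:
  assumes "f \<in> Hom C A B" "c \<in> Hom C B K" "c \<cdot> f = Zero C A K"
    and "\<And>X h. h \<in> Hom C B X \<Longrightarrow> h \<cdot> f = Zero C A X \<Longrightarrow> \<exists>!u. u \<in> Hom C K X \<and> u \<cdot> c = h"
  shows "is_cokernel C c f"
  using assms Hom_src_tgt[OF assms(1)] Hom_src_tgt[OF assms(2)] unfolding is_cokernel_def by auto

lemma kernel_Comp:
  assumes "is_kernel C k f" "f \<in> Hom C A B"
  shows "f \<cdot> k = Zero C (src C k) B"
  using assms unfolding is_kernel_def Hom_def by auto

lemma cokernel_Comp:
  assumes "is_cokernel C c f" "f \<in> Hom C A B"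
  shows "c \<cdot> f = Zero C A (tgt C c)"
  using assms unfolding is_cokernel_def Hom_def by auto

lemma kernel_factor:
  assumes "is_kernel C k f" "f \<in> Hom C A B" "h \<in> Hom C X A" "f \<cdot> h = Zero C X B"
  obtains u where "u \<in> Hom C X (src C k)" "k \<cdot> u = h"
  using assms Hom_Obj[OF assms(3)] Hom_src_tgt[OF assms(2)] unfolding is_kernel_def by metis

lemma cokernel_factor:
  assumes "is_cokernel C c f" "f \<in> Hom C A B" "h \<in> Hom C B X" "h \<cdot> f = Zero C A X"
  obtains u where "u \<in> Hom C (tgt C c) X" "u \<cdot> c = h"
  using assms Hom_Obj[OF assms(3)] Hom_src_tgt[OF assms(2)] unfolding is_cokernel_def by metis

lemma kernel_mono:
  assumes "is_kernel C k f"
  shows "mono_mor C k"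
proof -
  have f: "f \<in> Hom C (src C f) (tgt C f)" using assms by (simp add: is_kernel_def Hom_def)
  have k: "k \<in> Hom C (src C k) (src C f)" using kernel_Hom[OF assms f] .
  have "u = v" if u: "u \<in> Hom C A (src C k)" and v: "v \<in> Hom C A (src C k)"
    and e: "k \<cdot> u = k \<cdot> v" for A u v
  proof -
    have ku: "k \<cdot> u \<in> Hom C A (src C f)" using Comp_Hom u k by blast
    have "f \<cdot> (k \<cdot> u) = Zero C A (tgt C f)"
      using Comp_assoc[OF u k f] kernel_Comp[OF assms f] Zero_Comp[OF u] Hom_Obj[OF f] by simp
    then have "\<exists>!w. w \<in> Hom C A (src C k) \<and> k \<cdot> w = k \<cdot> u"
      using assms ku Hom_Obj(1)[OF u] unfolding is_kernel_def by blast
    then show "u = v" using u v e by metis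
  qed
  then show ?thesis using k unfolding mono_mor_def by (auto simp: Hom_def)
qed

lemma cokernel_epi:
  assumes "is_cokernel C c f"
  shows "epi_mor C c"
proof -
  have f: "f \<in> Hom C (src C f) (tgt C f)" using assms by (simp add: is_cokernel_def Hom_def)
  have c: "c \<in> Hom C (tgt C f) (tgt C c)" using cokernel_Hom[OF assms f] .
  have "u = v" if u: "u \<in> Hom C (tgt C c) A" and v: "v \<in> Hom C (tgt C c) A"
    and e: "u \<cdot> c = v \<cdot> c" for A u v
  proof -
    have uc: "u \<cdot> c \<in> Hom C (tgt C f) A" using Comp_Hom u c by blast
    have "(u \<cdot> c) \<cdot> f = Zero C (src C f) A"
      using Comp_assoc[OF f c u] cokernel_Comp[OF assms f] Comp_Zero[OF u] Hom_Obj[OF f] by simp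
    then have "\<exists>!w. w \<in> Hom C (tgt C c) A \<and> w \<cdot> c = u \<cdot> c"
      using assms uc Hom_Obj(2)[OF u] unfolding is_cokernel_def by blast
    then show "u = v" using u v e by metis
  qed
  then show ?thesis using c unfolding epi_mor_def by (auto simp: Hom_def)
qed

lemma mono_Comp:
  assumes f: "f \<in> Hom C A B" and g: "g \<in> Hom C B D" and mf: "mono_mor C f" and mg: "mono_mor C g"
  shows "mono_mor C (g \<cdot> f)"
proof -
  have gf: "g \<cdot> f \<in> Hom C A D" using Comp_Hom[OF f g] .
  have "u = v" if u: "u \<in> Hom C E A" and v: "v \<in> Hom C E A" and e: "(g \<cdot> f) \<cdot> u = (g \<cdot> f) \<cdot> v" for u v E
  proof -
    have "g \<cdot> (f \<cdot> u) = g \<cdot> (f \<cdot> v)"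
      using e Comp_assoc[OF u f g] Comp_assoc[OF v f g] by simp
    then have "f \<cdot> u = f \<cdot> v"
      using mono_cancel[OF mg g] u v Comp_Hom[OF _ f] by blast
    then show ?thesis using mono_cancel[OF mf f] u v by blast
  qed
  then show ?thesis using gf Hom_src_tgt[OF gf] unfolding mono_mor_def by auto
qed

end

section \<open>Images, biproducts, pullbacks and pushouts\<close>

context abelian_category
begin

text \<open>
  By normality \<open>p\<close> is a cokernel of some \<open>g\<close>. Since \<open>g\<close> factors through the kernel \<open>k\<close> of \<open>p\<close>, a
  morphism that kills \<open>k\<close> also kills \<open>g\<close> and so factors through \<open>p\<close>.
\<close>

lemma epi_cokernel_of_kernel:
  assumes p: "p \<in> Hom C A B" and e: "epi_mor C p" and k: "is_kernel C k p"
  shows "is_cokernel C p k"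
proof -
  obtain g where g: "is_cokernel C p g" using epi_normal[OF e] by blast
  have kH: "k \<in> Hom C (src C k) A" using kernel_Hom[OF k p] .
  have gH: "g \<in> Hom C (src C g) A" using g p unfolding is_cokernel_def Hom_def by auto
  have "p \<cdot> g = Zero C (src C g) B" using cokernel_Comp[OF g gH] p by (simp add: Hom_def)
  then obtain s where s: "s \<in> Hom C (src C g) (src C k)" "k \<cdot> s = g"
    using kernel_factor[OF k p gH] by blast
  show ?thesis
  proof (rule cokernelI[OF kH p kernel_Comp[OF k p]])
    fix X h assume h: "h \<in> Hom C A X" and hk: "h \<cdot> k = Zero C (src C k) X"
    have "h \<cdot> g = Zero C (src C g) X"
      using Comp_assoc[OF s(1) kH h] hk s Zero_Comp[OF s(1)] Hom_Obj[OF h] by simp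
    then obtain u where "u \<in> Hom C B X" "u \<cdot> p = h"
      using cokernel_factor[OF g gH h] Hom_src_tgt[OF p] by auto
    then show "\<exists>!u. u \<in> Hom C B X \<and> u \<cdot> p = h"
      using epi_cancel[OF e p] by blast
  qed
qed

text \<open>
  Take \<open>c\<close> to be a cokernel of \<open>f\<close> and \<open>m\<close> a kernel of \<open>c\<close>. The point is that \<open>e\<close> is epi: if \<open>w \<cdot> e = 0\<close>
  and \<open>k\<close> is a kernel of \<open>w\<close>, then \<open>f\<close> factors through the monomorphism \<open>m \<cdot> k\<close>, which is itself the
  kernel of some \<open>g\<close>. Now \<open>g\<close> kills \<open>f\<close>, hence it factors through \<open>c\<close> and kills \<open>m\<close>. So \<open>m\<close> factors
  through \<open>m \<cdot> k\<close>, which makes \<open>k\<close> a split epimorphism and \<open>w\<close> zero.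
\<close>

lemma image_factorization:
  assumes f: "f \<in> Hom C A B"
  obtains m I e c where "m \<in> Hom C I B" "e \<in> Hom C A I" "c \<in> Hom C B (tgt C c)"
    "f = m \<cdot> e" "epi_mor C e" "epi_mor C c" "is_kernel C m c"
proof -
  obtain c where c: "is_cokernel C c f" using ex_cokernel f by (auto simp: Hom_def)
  have cH: "c \<in> Hom C B (tgt C c)" using cokernel_Hom[OF c f] .
  obtain m where m: "is_kernel C m c" using ex_kernel cH by (auto simp: Hom_def)
  have mH: "m \<in> Hom C (src C m) B" using kernel_Hom[OF m cH] .
  obtain e where e: "e \<in> Hom C A (src C m)" "m \<cdot> e = f"
    using kernel_factor[OF m cH f cokernel_Comp[OF c f]] .
  have "epi_mor C e"
  proof (rule epiI[OF e(1)])
    fix D w assume w: "w \<in> Hom C (src C m) D" and we: "w \<cdot> e = Zero C A D"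
    obtain k where k: "is_kernel C k w" using ex_kernel w by (auto simp: Hom_def)
    have kH: "k \<in> Hom C (src C k) (src C m)" using kernel_Hom[OF k w] .
    obtain e' where e': "e' \<in> Hom C A (src C k)" "k \<cdot> e' = e" using kernel_factor[OF k w e(1) we] .
    have mkH: "m \<cdot> k \<in> Hom C (src C k) B" using Comp_Hom[OF kH mH] .
    obtain g where g: "is_kernel C (m \<cdot> k) g"
      using mono_normal[OF mono_Comp[OF kH mH kernel_mono[OF k] kernel_mono[OF m]]] by blast
    have gH: "g \<in> Hom C B (tgt C g)" using g mkH unfolding is_kernel_def Hom_def by auto
    have gmk: "g \<cdot> (m \<cdot> k) = Zero C (src C k) (tgt C g)"
      using kernel_Comp[OF g gH] Hom_src_tgt[OF mkH] by simp
    have "g \<cdot> f = (g \<cdot> (m \<cdot> k)) \<cdot> e'"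
      using Comp_assoc[OF e'(1) mkH gH] Comp_assoc[OF e'(1) kH mH] e e' by simp
    then have "g \<cdot> f = Zero C A (tgt C g)"
      using gmk Zero_Comp[OF e'(1)] Hom_Obj[OF gH] by simp
    then obtain g' where g': "g' \<in> Hom C (tgt C c) (tgt C g)" "g' \<cdot> c = g"
      using cokernel_factor[OF c f gH] by blast
    have "g \<cdot> m = Zero C (src C m) (tgt C g)"
      using Comp_assoc[OF mH cH g'(1)] g'(2) kernel_Comp[OF m cH] Comp_Zero[OF g'(1)] Hom_Obj[OF mH]
      by simp
    then obtain s where s: "s \<in> Hom C (src C m) (src C k)" "(m \<cdot> k) \<cdot> s = m"
      using kernel_factor[OF g gH mH] Hom_src_tgt[OF mkH] by metis
    have "m \<cdot> (k \<cdot> s) = m \<cdot> ident C (src C m)"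
      using Comp_assoc[OF s(1) kH mH] s(2) Comp_ident[OF mH] by simp
    then have "k \<cdot> s = ident C (src C m)"
      using mono_cancel[OF kernel_mono[OF m] mH] Comp_Hom[OF s(1) kH] ident_Hom Hom_Obj[OF mH] by blast
    then have "w = (w \<cdot> k) \<cdot> s" using Comp_assoc[OF s(1) kH w] Comp_ident[OF w] by simp
    then show "w = Zero C (src C m) D"
      using kernel_Comp[OF k w] Zero_Comp[OF s(1)] Hom_Obj[OF w] by simp
  qed
  then show thesis using that[OF mH e(1) cH e(2)[symmetric]] cokernel_epi[OF c] m by blast
qed

lemma direct_sum_univ:
  assumes "is_direct_sum C n D M \<iota>" "B \<in> Obj C" "\<And>i. i < n \<Longrightarrow> g i \<in> Hom C (D i) B"
  shows "\<exists>!h. h \<in> Hom C M B \<and> (\<forall>i<n. h \<cdot> \<iota> i = g i)"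
  using assms by (simp add: is_direct_sum_def)

text \<open>
  The projections come from the coproduct property applied to the identity and zero morphisms;
  \<open>i \<cdot> p + j \<cdot> q\<close> is the identity since both have the same composites with \<open>i\<close> and \<open>j\<close>.
\<close>

lemma ex_biproduct:
  assumes "A \<in> Obj C" "B \<in> Obj C"
  obtains i M j p q where "i \<in> Hom C A M" "j \<in> Hom C B M" "p \<in> Hom C M A" "q \<in> Hom C M B"
    "p \<cdot> i = ident C A" "q \<cdot> j = ident C B" "q \<cdot> i = Zero C A B" "p \<cdot> j = Zero C B A"
    "Add C (i \<cdot> p) (j \<cdot> q) = ident C M"
    "\<forall>D. \<forall>f\<in>Hom C A D. \<forall>g\<in>Hom C B D. \<exists>!h. h \<in> Hom C M D \<and> h \<cdot> i = f \<and> h \<cdot> j = g"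
proof -
  let ?D = "\<lambda>k. if k = (0::nat) then A else B"
  have "\<forall>k<(2::nat). ?D k \<in> Obj C" using assms by simp
  then obtain M \<iota> where M: "is_direct_sum C 2 ?D M \<iota>" using ex_direct_sum[of 2 ?D] by blast
  define i j where "i = \<iota> 0" and "j = \<iota> 1"
  have all2: "(\<forall>k<(2::nat). Q k) \<longleftrightarrow> Q 0 \<and> Q 1" for Q by (auto simp: less_2_cases_iff)
  have MO: "M \<in> Obj C" and i: "i \<in> Hom C A M" and j: "j \<in> Hom C B M"
    using M unfolding is_direct_sum_def i_def j_def all2 by auto
  have univ: "\<exists>!h. h \<in> Hom C M D \<and> h \<cdot> i = f \<and> h \<cdot> j = g"
    if "f \<in> Hom C A D" "g \<in> Hom C B D" for D f g
  proof -
    let ?g = "\<lambda>k. if k = (0::nat) then f else g"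
    have g: "?g k \<in> Hom C (?D k) D" for k using that by simp
    have "\<exists>!h. h \<in> Hom C M D \<and> (\<forall>k<2. h \<cdot> \<iota> k = ?g k)"
      by (rule direct_sum_univ[OF M Hom_Obj(2)[OF that(1)] g])
    then show ?thesis unfolding all2 i_def j_def by simp
  qed
  note idA = ident_Hom[OF assms(1)] and idB = ident_Hom[OF assms(2)]
  obtain p where p: "p \<in> Hom C M A" "p \<cdot> i = ident C A" "p \<cdot> j = Zero C B A"
    using univ[OF idA Zero_Hom[OF assms(2,1)]] by blast
  obtain q where q: "q \<in> Hom C M B" "q \<cdot> i = Zero C A B" "q \<cdot> j = ident C B"
    using univ[OF Zero_Hom[OF assms] idB] by blast
  have ip: "i \<cdot> p \<in> Hom C M M" and jq: "j \<cdot> q \<in> Hom C M M" using Comp_Hom i j p q by blast+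
  let ?s = "Add C (i \<cdot> p) (j \<cdot> q)"
  have s: "?s \<in> Hom C M M" using Add_Hom[OF ip jq] .
  have "?s \<cdot> i = i"
    using Add_Comp[OF i ip jq] Comp_assoc[OF i p(1) i] Comp_assoc[OF i q(1) j] p q
      Comp_ident[OF i] Comp_Zero[OF j assms(1)] Add_Zero[OF i] by simp
  moreover have "?s \<cdot> j = j"
    using Add_Comp[OF j ip jq] Comp_assoc[OF j p(1) i] Comp_assoc[OF j q(1) j] p q
      Comp_ident[OF j] Comp_Zero[OF i assms(2)] Add_Zero[OF j] by simp
  ultimately have "?s = ident C M"
    using univ[OF i j] s ident_Hom[OF MO] ident_Comp[OF i] ident_Comp[OF j] by blast
  then show thesis using that[OF i j p(1) q(1) p(2) q(3) q(2) p(3)] univ by simp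
qed

text \<open>
  The pullback is the kernel of \<open>\<phi> = (p, -g) : A \<oplus> B \<rightarrow> Q\<close>. Epimorphisms are stable under pullback
  because \<open>\<phi>\<close> is epi, hence the cokernel of its kernel \<open>k\<close>: if \<open>u\<close> kills the projection \<open>b\<close> of the
  pullback to \<open>B\<close>, then \<open>u\<close> after the projection of \<open>A \<oplus> B\<close> to \<open>B\<close> is \<open>v \<cdot> \<phi>\<close> for some \<open>v\<close>;
  restriction to \<open>A\<close> gives \<open>v \<cdot> p = 0\<close>, so \<open>v = 0\<close> and \<open>u = 0\<close>.
\<close>

lemma ex_pullback_epi:
  assumes p: "p \<in> Hom C A Q" and g: "g \<in> Hom C B Q" and ep: "epi_mor C p"
  obtains a E b where "a \<in> Hom C E A" "b \<in> Hom C E B" "p \<cdot> a = g \<cdot> b" "epi_mor C b"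
    "\<forall>X. \<forall>x\<in>Hom C X A. \<forall>y\<in>Hom C X B. p \<cdot> x = g \<cdot> y \<longrightarrow>
      (\<exists>!u. u \<in> Hom C X E \<and> a \<cdot> u = x \<and> b \<cdot> u = y)"
proof -
  have O: "A \<in> Obj C" "B \<in> Obj C" "Q \<in> Obj C" using Hom_Obj p g by blast+
  obtain i M j r s where i: "i \<in> Hom C A M" and j: "j \<in> Hom C B M"
    and r: "r \<in> Hom C M A" and s: "s \<in> Hom C M B"
    and id: "r \<cdot> i = ident C A" "s \<cdot> j = ident C B" "s \<cdot> i = Zero C A B" "r \<cdot> j = Zero C B A"
    and sum: "Add C (i \<cdot> r) (j \<cdot> s) = ident C M"
    and univ[rule_format]: "\<forall>D. \<forall>f\<in>Hom C A D. \<forall>g\<in>Hom C B D. \<exists>!h. h \<in> Hom C M D \<and> h \<cdot> i = f \<and> h \<cdot> j = g"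
    using ex_biproduct[OF O(1,2)] .
  \<comment> \<open>\<open>n\<close> is \<open>-g\<close>\<close>
  obtain n where n: "n \<in> Hom C B Q" "Add C g n = Zero C B Q"
    using ex_difference[OF g Zero_Hom[OF O(2,3)]] .
  obtain \<phi> where \<phi>: "\<phi> \<in> Hom C M Q" "\<phi> \<cdot> i = p" "\<phi> \<cdot> j = n" using univ[OF p n(1)] by blast
  have ir: "i \<cdot> r \<in> Hom C M M" and js: "j \<cdot> s \<in> Hom C M M" using Comp_Hom i j r s by blast+
  have expand: "\<phi> \<cdot> z = Add C (p \<cdot> (r \<cdot> z)) (n \<cdot> (s \<cdot> z))" if z: "z \<in> Hom C X M" for X z
  proof -
    have "\<phi> = Add C (\<phi> \<cdot> (i \<cdot> r)) (\<phi> \<cdot> (j \<cdot> s))"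
      using Comp_Add[OF ir js \<phi>(1)] sum Comp_ident[OF \<phi>(1)] by simp
    then have "\<phi> = Add C (p \<cdot> r) (n \<cdot> s)"
      using Comp_assoc[OF r i \<phi>(1)] Comp_assoc[OF s j \<phi>(1)] \<phi> by simp
    then show ?thesis
      using Add_Comp[OF z Comp_Hom[OF r p] Comp_Hom[OF s n(1)]]
        Comp_assoc[OF z r p] Comp_assoc[OF z s n(1)] by simp
  qed
  have iff: "\<phi> \<cdot> z = Zero C X Q \<longleftrightarrow> p \<cdot> (r \<cdot> z) = g \<cdot> (s \<cdot> z)" if z: "z \<in> Hom C X M" for X z
  proof -
    have rz: "r \<cdot> z \<in> Hom C X A" and sz: "s \<cdot> z \<in> Hom C X B" using Comp_Hom z r s by blast+
    have H: "p \<cdot> (r \<cdot> z) \<in> Hom C X Q" "g \<cdot> (s \<cdot> z) \<in> Hom C X Q" "n \<cdot> (s \<cdot> z) \<in> Hom C X Q"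
      using Comp_Hom rz sz p g n by blast+
    have "Add C (g \<cdot> (s \<cdot> z)) (n \<cdot> (s \<cdot> z)) = Zero C X Q"
      using Add_Comp[OF sz g n(1)] n(2) Zero_Comp[OF sz O(3)] by simp
    then show ?thesis using expand[OF z] Add_right_cancel[OF H(3) H(1) H(2)] by metis
  qed
  have e\<phi>: "epi_mor C \<phi>"
  proof (rule epiI[OF \<phi>(1)])
    fix D u assume u: "u \<in> Hom C Q D" and "u \<cdot> \<phi> = Zero C M D"
    then have "u \<cdot> p = Zero C A D"
      using Comp_assoc[OF i \<phi>(1) u] \<phi>(2) Zero_Comp[OF i] Hom_Obj[OF u] by simp
    then show "u = Zero C Q D" using epi_cancel_Zero[OF ep p u] by blast
  qed
  obtain k where k: "is_kernel C k \<phi>" using ex_kernel \<phi>(1) by (auto simp: Hom_def)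
  define E where "E = src C k"
  have kH: "k \<in> Hom C E M" using kernel_Hom[OF k \<phi>(1)] by (simp add: E_def)
  have rk: "r \<cdot> k \<in> Hom C E A" and sk: "s \<cdot> k \<in> Hom C E B" using Comp_Hom kH r s by blast+
  have comm: "p \<cdot> (r \<cdot> k) = g \<cdot> (s \<cdot> k)"
    using iff[OF kH] kernel_Comp[OF k \<phi>(1)] by (simp add: E_def)
  have coker: "is_cokernel C \<phi> k" using epi_cokernel_of_kernel[OF \<phi>(1) e\<phi> k] .
  have "epi_mor C (s \<cdot> k)"
  proof (rule epiI[OF sk])
    fix D u assume u: "u \<in> Hom C B D" and uz: "u \<cdot> (s \<cdot> k) = Zero C E D"
    have us: "u \<cdot> s \<in> Hom C M D" using Comp_Hom[OF s u] .
    have "(u \<cdot> s) \<cdot> k = Zero C E D" using uz Comp_assoc[OF kH s u] by simp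
    then obtain v where v: "v \<in> Hom C Q D" "v \<cdot> \<phi> = u \<cdot> s"
      using cokernel_factor[OF coker kH us] Hom_src_tgt[OF \<phi>(1)] by auto
    have "v \<cdot> p = u \<cdot> (s \<cdot> i)"
      using Comp_assoc[OF i \<phi>(1) v(1)] Comp_assoc[OF i s u] v(2) \<phi>(2) by simp
    then have "v \<cdot> p = Zero C A D" using id Comp_Zero[OF u O(1)] by simp
    then have "v = Zero C Q D" using epi_cancel_Zero[OF ep p v(1)] by blast
    then have "u \<cdot> s = Zero C M D" using v(2) Zero_Comp[OF \<phi>(1)] Hom_Obj[OF u] by simp
    then show "u = Zero C B D"
      using Comp_assoc[OF j s u] id(2) Comp_ident[OF u] Zero_Comp[OF j] Hom_Obj[OF u] by simp
  qed
  moreover have "\<exists>!u. u \<in> Hom C X E \<and> (r \<cdot> k) \<cdot> u = x \<and> (s \<cdot> k) \<cdot> u = y"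
    if x: "x \<in> Hom C X A" and y: "y \<in> Hom C X B" and xy: "p \<cdot> x = g \<cdot> y" for X x y
  proof -
    have XO: "X \<in> Obj C" using Hom_Obj[OF x] by blast
    have ix: "i \<cdot> x \<in> Hom C X M" and jy: "j \<cdot> y \<in> Hom C X M" using Comp_Hom i j x y by blast+
    define z where "z = Add C (i \<cdot> x) (j \<cdot> y)"
    have z: "z \<in> Hom C X M" unfolding z_def using Add_Hom[OF ix jy] .
    have rz: "r \<cdot> z = x"
      unfolding z_def using Comp_Add[OF ix jy r] Comp_assoc[OF x i r] Comp_assoc[OF y j r] id
        ident_Comp[OF x] Zero_Comp[OF y O(1)] Add_Zero[OF x] by simp
    have sz: "s \<cdot> z = y"
      unfolding z_def using Comp_Add[OF ix jy s] Comp_assoc[OF x i s] Comp_assoc[OF y j s] id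
        ident_Comp[OF y] Zero_Comp[OF x O(2)] Add_Zero[OF y] by simp
    have "\<phi> \<cdot> z = Zero C X Q" using iff[OF z] rz sz xy by simp
    then obtain u where u: "u \<in> Hom C X E" "k \<cdot> u = z"
      using kernel_factor[OF k \<phi>(1) z] unfolding E_def by blast
    have ex: "(r \<cdot> k) \<cdot> u = x" "(s \<cdot> k) \<cdot> u = y"
      using Comp_assoc[OF u(1) kH r] Comp_assoc[OF u(1) kH s] u(2) rz sz by simp_all
    have "u' = u" if u': "u' \<in> Hom C X E" and "(r \<cdot> k) \<cdot> u' = x" "(s \<cdot> k) \<cdot> u' = y" for u'
    proof -
      have ku: "k \<cdot> u' \<in> Hom C X M" using Comp_Hom[OF u' kH] .
      have "k \<cdot> u' = Add C (i \<cdot> r) (j \<cdot> s) \<cdot> (k \<cdot> u')" using sum ident_Comp[OF ku] by simp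
      also have "\<dots> = Add C (i \<cdot> (r \<cdot> (k \<cdot> u'))) (j \<cdot> (s \<cdot> (k \<cdot> u')))"
        using Add_Comp[OF ku ir js] Comp_assoc[OF ku r i] Comp_assoc[OF ku s j] by simp
      also have "\<dots> = z"
        using Comp_assoc[OF u' kH r] Comp_assoc[OF u' kH s] that z_def by simp
      finally show ?thesis
        using mono_cancel[OF kernel_mono[OF k] kH u' u(1)] u(2) by simp
    qed
    then show ?thesis using u(1) ex by blast
  qed
  ultimately show thesis using that[OF rk sk comm] by simp
qed

text \<open>
  The pushout is the cokernel of \<open>\<delta> = (f, -p) : P \<rightarrow> T \<oplus> A\<close>. A morphism out of it that vanishes on
  \<open>T\<close> vanishes on \<open>A\<close> after composition with \<open>p\<close>, hence on \<open>A\<close>; this is why \<open>b\<close> inherits being epi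
  from \<open>p\<close>.
\<close>

lemma ex_pushout_epi:
  assumes f: "f \<in> Hom C P T" and p: "p \<in> Hom C P A" and ep: "epi_mor C p"
  obtains b B d where "b \<in> Hom C T B" "d \<in> Hom C A B" "b \<cdot> f = d \<cdot> p" "epi_mor C b"
    "\<forall>X. \<forall>x\<in>Hom C T X. \<forall>y\<in>Hom C A X. x \<cdot> f = y \<cdot> p \<longrightarrow>
      (\<exists>!u. u \<in> Hom C B X \<and> u \<cdot> b = x \<and> u \<cdot> d = y)"
proof -
  have O: "A \<in> Obj C" "T \<in> Obj C" "P \<in> Obj C" using Hom_Obj p f by blast+
  obtain i M j r s where i: "i \<in> Hom C T M" and j: "j \<in> Hom C A M"
    and r: "r \<in> Hom C M T" and s: "s \<in> Hom C M A"
    and "r \<cdot> i = ident C T" "s \<cdot> j = ident C A" "s \<cdot> i = Zero C T A" "r \<cdot> j = Zero C A T"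
    and "Add C (i \<cdot> r) (j \<cdot> s) = ident C M"
    and univ[rule_format]: "\<forall>D. \<forall>f\<in>Hom C T D. \<forall>g\<in>Hom C A D. \<exists>!h. h \<in> Hom C M D \<and> h \<cdot> i = f \<and> h \<cdot> j = g"
    using ex_biproduct[OF O(2,1)] .
  \<comment> \<open>\<open>n\<close> is \<open>-p\<close>\<close>
  obtain n where n: "n \<in> Hom C P A" "Add C p n = Zero C P A"
    using ex_difference[OF p Zero_Hom[OF O(3,1)]] .
  have ifH: "i \<cdot> f \<in> Hom C P M" and jn: "j \<cdot> n \<in> Hom C P M" using Comp_Hom i j f n by blast+
  define \<delta> where "\<delta> = Add C (i \<cdot> f) (j \<cdot> n)"
  have \<delta>: "\<delta> \<in> Hom C P M" unfolding \<delta>_def using Add_Hom[OF ifH jn] .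
  have iff: "z \<cdot> \<delta> = Zero C P X \<longleftrightarrow> (z \<cdot> i) \<cdot> f = (z \<cdot> j) \<cdot> p" if z: "z \<in> Hom C M X" for X z
  proof -
    have zi: "z \<cdot> i \<in> Hom C T X" and zj: "z \<cdot> j \<in> Hom C A X" using Comp_Hom z i j by blast+
    have H: "(z \<cdot> i) \<cdot> f \<in> Hom C P X" "(z \<cdot> j) \<cdot> p \<in> Hom C P X" "(z \<cdot> j) \<cdot> n \<in> Hom C P X"
      using Comp_Hom zi zj p f n by blast+
    have "z \<cdot> \<delta> = Add C ((z \<cdot> i) \<cdot> f) ((z \<cdot> j) \<cdot> n)"
      unfolding \<delta>_def using Comp_Add[OF ifH jn z] Comp_assoc[OF f i z] Comp_assoc[OF n(1) j z] by simp
    moreover have "Add C ((z \<cdot> j) \<cdot> p) ((z \<cdot> j) \<cdot> n) = Zero C P X"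
      using Comp_Add[OF p n(1) zj] n(2) Comp_Zero[OF zj O(3)] by simp
    ultimately show ?thesis using Add_right_cancel[OF H(3) H(1) H(2)] by metis
  qed
  obtain c where c: "is_cokernel C c \<delta>" using ex_cokernel \<delta> by (auto simp: Hom_def)
  define B where "B = tgt C c"
  have cH: "c \<in> Hom C M B" using cokernel_Hom[OF c \<delta>] by (simp add: B_def)
  have ci: "c \<cdot> i \<in> Hom C T B" and cj: "c \<cdot> j \<in> Hom C A B" using Comp_Hom cH i j by blast+
  have comm: "(c \<cdot> i) \<cdot> f = (c \<cdot> j) \<cdot> p"
    using iff[OF cH] cokernel_Comp[OF c \<delta>] by (simp add: B_def)
  have eci: "epi_mor C (c \<cdot> i)"
  proof (rule epiI[OF ci])
    fix D u assume u: "u \<in> Hom C B D" and uz: "u \<cdot> (c \<cdot> i) = Zero C T D"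
    have DO: "D \<in> Obj C" using Hom_Obj[OF u] by blast
    have ucj: "u \<cdot> (c \<cdot> j) \<in> Hom C A D" using Comp_Hom[OF cj u] .
    have "(u \<cdot> (c \<cdot> j)) \<cdot> p = (u \<cdot> (c \<cdot> i)) \<cdot> f"
      using Comp_assoc[OF p cj u] Comp_assoc[OF f ci u] comm by simp
    then have "(u \<cdot> (c \<cdot> j)) \<cdot> p = Zero C P D" using uz Zero_Comp[OF f DO] by simp
    then have "u \<cdot> (c \<cdot> j) = Zero C A D" using epi_cancel_Zero[OF ep p ucj] by blast
    then have "(u \<cdot> c) \<cdot> j = Zero C A D" "(u \<cdot> c) \<cdot> i = Zero C T D"
      using Comp_assoc[OF j cH u] Comp_assoc[OF i cH u] uz by simp_all
    moreover have "Zero C M D \<cdot> j = Zero C A D" "Zero C M D \<cdot> i = Zero C T D"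
      using Zero_Comp[OF j DO] Zero_Comp[OF i DO] by simp_all
    ultimately have "u \<cdot> c = Zero C M D"
      using univ[of "Zero C T D" D "Zero C A D"] Zero_Hom O DO Hom_Obj(1)[OF cH] Comp_Hom[OF cH u]
      by blast
    then show "u = Zero C B D" using epi_cancel_Zero[OF cokernel_epi[OF c] cH u] by blast
  qed
  moreover have "\<exists>!u. u \<in> Hom C B X \<and> u \<cdot> (c \<cdot> i) = x \<and> u \<cdot> (c \<cdot> j) = y"
    if x: "x \<in> Hom C T X" and y: "y \<in> Hom C A X" and xy: "x \<cdot> f = y \<cdot> p" for X x y
  proof -
    obtain z where z: "z \<in> Hom C M X" "z \<cdot> i = x" "z \<cdot> j = y" using univ[OF x y] by blast
    have "z \<cdot> \<delta> = Zero C P X" using iff[OF z(1)] z xy by simp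
    then obtain u where u: "u \<in> Hom C B X" "u \<cdot> c = z"
      using cokernel_factor[OF c \<delta> z(1)] unfolding B_def by blast
    then have "u \<cdot> (c \<cdot> i) = x" "u \<cdot> (c \<cdot> j) = y"
      using Comp_assoc[OF i cH u(1)] Comp_assoc[OF j cH u(1)] z by simp_all
    moreover have "u' = u" if "u' \<in> Hom C B X" "u' \<cdot> (c \<cdot> i) = x" for u'
      using epi_cancel[OF eci ci that(1) u(1)] that(2) calculation(1) by simp
    ultimately show ?thesis using u(1) by blast
  qed
  ultimately show thesis using that[OF ci cj comm] eci by simp
qed

section \<open>Short exact sequences and lifting\<close>

lemma zero_obj_Hom_eq:
  assumes "zero_obj C Z" "A \<in> Obj C"
  shows "f \<in> Hom C A Z \<longleftrightarrow> f = Zero C A Z" "f \<in> Hom C Z A \<longleftrightarrow> f = Zero C Z A"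
  using assms Zero_Hom[of A Z] Zero_Hom[of Z A] unfolding zero_obj_def by metis+

text \<open>
  Exactness at each of the three places requires naming an image that is also a kernel: the zero
  morphism at the left end, \<open>i\<close> in the middle and the identity of \<open>X\<close> at the right end.
\<close>

lemma short_exactI:
  assumes p: "p \<in> Hom C E X" and i: "is_kernel C i p" and ep: "epi_mor C p"
  shows "short_exact C i p"
proof -
  obtain Z where Z: "zero_obj C Z" using ex_zero_obj by blast
  define Y where "Y = src C i"
  have iH: "i \<in> Hom C Y E" unfolding Y_def using kernel_Hom[OF i p] .
  have O: "X \<in> Obj C" "E \<in> Obj C" "Y \<in> Obj C" "Z \<in> Obj C"
    using Hom_Obj iH p Z unfolding zero_obj_def by blast+
  note Zz = zero_obj_Hom_eq[OF Z]
  have zY: "Zero C Z Y \<in> Hom C Z Y" and zX: "Zero C X Z \<in> Hom C X Z" using Zero_Hom O by blast+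
  have idY: "ident C Y \<in> Hom C Y Y" and idX: "ident C X \<in> Hom C X X" using ident_Hom O by blast+
  \<comment> \<open>A monomorphism out of \<open>Y\<close> has zero kernel; this is used for \<open>i\<close> and for the identity.\<close>
  have ker0: "is_kernel C (Zero C Z Y) m" if m: "m \<in> Hom C Y D" "mono_mor C m" for m D
  proof (rule kernelI[OF zY m(1)])
    show "m \<cdot> Zero C Z Y = Zero C Z D" using Comp_Zero[OF m(1) O(4)] .
    fix V h assume h: "h \<in> Hom C V Y" and mh: "m \<cdot> h = Zero C V D"
    have VO: "V \<in> Obj C" using Hom_Obj[OF h] by blast
    have "m \<cdot> h = m \<cdot> Zero C V Y" using mh Comp_Zero[OF m(1) VO] by simp
    then have "h = Zero C V Y" using mono_cancel[OF m(2,1) h] Zero_Hom[OF VO O(3)] by blast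
    then show "\<exists>!u. u \<in> Hom C V Z \<and> Zero C Z Y \<cdot> u = h"
      using Zz(1)[OF VO] Comp_Zero[OF zY VO] by metis
  qed
  have "mono_mor C (ident C Y)"
    using ident_Comp Hom_src_tgt[OF idY] unfolding mono_mor_def by metis
  then have 1: "is_kernel C (Zero C Z Y) (ident C Y)" using ker0 idY by blast
  have 2: "is_cokernel C (ident C Y) (Zero C Z Y)"
    by (rule cokernelI[OF zY idY])
      (use Comp_Zero[OF idY O(4)] Comp_ident in \<open>auto\<close>)
  have 3: "is_kernel C (Zero C Z Y) i" using ker0[OF iH kernel_mono[OF i]] .
  have 4: "is_cokernel C p i" using epi_cokernel_of_kernel[OF p ep i] .
  have 5: "is_kernel C (ident C X) (Zero C X Z)"
    by (rule kernelI[OF idX zX])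
      (use Zero_Comp[OF idX O(4)] ident_Comp in \<open>auto\<close>)
  have 6: "is_cokernel C (Zero C X Z) p"
  proof (rule cokernelI[OF p zX Zero_Comp[OF p O(4)]])
    fix V h assume h: "h \<in> Hom C X V" and "h \<cdot> p = Zero C E V"
    then have "h = Zero C X V" using epi_cancel_Zero[OF ep p h] by blast
    then show "\<exists>!u. u \<in> Hom C Z V \<and> u \<cdot> Zero C X Z = h"
      using Zz(2)[OF Hom_Obj(2)[OF h]] Zero_Comp[OF zX Hom_Obj(2)[OF h]] by metis
  qed
  have "exact_at C (Zero C Z Y) i" "exact_at C i p" "exact_at C p (Zero C X Z)"
    unfolding exact_at_def is_image_def using 1 2 3 4 5 6 i by blast+
  then show ?thesis
    unfolding short_exact_def exact_seq_def using Z Hom_src_tgt[OF p]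
    by (auto simp: Y_def)
qed

text \<open>
  The extension obtained by pulling \<open>0 \<rightarrow> Y \<rightarrow> A \<rightarrow> Q \<rightarrow> 0\<close> back along \<open>g\<close> and the split extension
  \<open>0 \<rightarrow> Y \<rightarrow> Y \<oplus> T \<rightarrow> T \<rightarrow> 0\<close> lie in the same class, since there is only one. The isomorphism between
  them carries the inclusion of \<open>T\<close> to a section of the pullback, and a section of the pullback is
  the same as a lift of \<open>g\<close>.
\<close>

lemma Ext1_zero_lift:
  assumes ext: "Ext1_zero C T (src C i)" and p: "p \<in> Hom C A Q" and ker: "is_kernel C i p"
    and ep: "epi_mor C p" and g: "g \<in> Hom C T Q"
  shows "\<exists>l\<in>Hom C T A. p \<cdot> l = g"
proof -
  define Y where "Y = src C i"
  have iH: "i \<in> Hom C Y A" unfolding Y_def using kernel_Hom[OF ker p] .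
  have O: "T \<in> Obj C" "Y \<in> Obj C" "Q \<in> Obj C" using Hom_Obj iH g by blast+
  obtain a E b where a: "a \<in> Hom C E A" and b: "b \<in> Hom C E T" and ab: "p \<cdot> a = g \<cdot> b"
    and eb: "epi_mor C b"
    and univ[rule_format]: "\<forall>X. \<forall>x\<in>Hom C X A. \<forall>y\<in>Hom C X T. p \<cdot> x = g \<cdot> y \<longrightarrow>
      (\<exists>!u. u \<in> Hom C X E \<and> a \<cdot> u = x \<and> b \<cdot> u = y)"
    using ex_pullback_epi[OF p g ep] .
  have zYT: "Zero C Y T \<in> Hom C Y T" using Zero_Hom O by blast
  have "p \<cdot> i = g \<cdot> Zero C Y T"
    using kernel_Comp[OF ker p] Comp_Zero[OF g O(2)] by (simp add: Y_def)
  then obtain j where j: "j \<in> Hom C Y E" "a \<cdot> j = i" "b \<cdot> j = Zero C Y T"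
    using univ[OF iH zYT] by blast
  \<comment> \<open>Pulling back preserves the kernel: \<open>0 \<rightarrow> Y \<rightarrow> E \<rightarrow> T \<rightarrow> 0\<close> is again an extension by \<open>Y\<close>.\<close>
  have kerj: "is_kernel C j b"
  proof (rule kernelI[OF j(1) b j(3)])
    fix X h assume h: "h \<in> Hom C X E" and bh: "b \<cdot> h = Zero C X T"
    have XO: "X \<in> Obj C" using Hom_Obj[OF h] by blast
    have ah: "a \<cdot> h \<in> Hom C X A" using Comp_Hom[OF h a] .
    have "p \<cdot> (a \<cdot> h) = g \<cdot> (b \<cdot> h)"
      using Comp_assoc[OF h a p] Comp_assoc[OF h b g] ab by simp
    then have pah: "p \<cdot> (a \<cdot> h) = Zero C X Q" using bh Comp_Zero[OF g XO] by simp
    then obtain u where u: "u \<in> Hom C X Y" "i \<cdot> u = a \<cdot> h"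
      using kernel_factor[OF ker p ah] unfolding Y_def by blast
    have ju: "j \<cdot> u \<in> Hom C X E" using Comp_Hom[OF u(1) j(1)] .
    have "a \<cdot> (j \<cdot> u) = a \<cdot> h" using Comp_assoc[OF u(1) j(1) a] j u by simp
    moreover have "b \<cdot> (j \<cdot> u) = b \<cdot> h"
      using Comp_assoc[OF u(1) j(1) b] j bh Zero_Comp[OF u(1) O(1)] by simp
    moreover have "b \<cdot> h \<in> Hom C X T" using Comp_Hom[OF h b] .
    moreover have "p \<cdot> (a \<cdot> h) = g \<cdot> (b \<cdot> h)" by fact
    ultimately have "j \<cdot> u = h" using univ[OF ah, of "b \<cdot> h"] h ju by blast
    moreover have "u' = u" if u': "u' \<in> Hom C X Y" and "j \<cdot> u' = h" for u'
    proof -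
      have "i \<cdot> u' = i \<cdot> u" using Comp_assoc[OF u' j(1) a] that j u by simp
      then show ?thesis using mono_cancel[OF kernel_mono[OF ker] iH u' u(1)] by blast
    qed
    ultimately show "\<exists>!u. u \<in> Hom C X Y \<and> j \<cdot> u = h" using u(1) by blast
  qed
  obtain k M l r s where k: "k \<in> Hom C Y M" and l: "l \<in> Hom C T M"
    and r: "r \<in> Hom C M Y" and s: "s \<in> Hom C M T"
    and id: "r \<cdot> k = ident C Y" "s \<cdot> l = ident C T" "s \<cdot> k = Zero C Y T" "r \<cdot> l = Zero C T Y"
    and sum: "Add C (k \<cdot> r) (l \<cdot> s) = ident C M"
    and "\<forall>D. \<forall>f\<in>Hom C Y D. \<forall>g\<in>Hom C T D. \<exists>!h. h \<in> Hom C M D \<and> h \<cdot> k = f \<and> h \<cdot> l = g"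
    using ex_biproduct[OF O(2,1)] .
  have es: "epi_mor C s"
  proof (rule epiI[OF s])
    fix D u assume u: "u \<in> Hom C T D" and "u \<cdot> s = Zero C M D"
    then show "u = Zero C T D"
      using Comp_assoc[OF l s u] id(2) Comp_ident[OF u] Zero_Comp[OF l] Hom_Obj[OF u] by simp
  qed
  have kerk: "is_kernel C k s"
  proof (rule kernelI[OF k s id(3)])
    fix X h assume h: "h \<in> Hom C X M" and sh: "s \<cdot> h = Zero C X T"
    have XO: "X \<in> Obj C" using Hom_Obj[OF h] by blast
    have rh: "r \<cdot> h \<in> Hom C X Y" using Comp_Hom[OF h r] .
    have krh: "k \<cdot> (r \<cdot> h) \<in> Hom C X M" using Comp_Hom[OF rh k] .
    have "h = Add C (k \<cdot> (r \<cdot> h)) (l \<cdot> (s \<cdot> h))"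
      using sum ident_Comp[OF h] Add_Comp[OF h Comp_Hom[OF r k] Comp_Hom[OF s l]]
        Comp_assoc[OF h r k] Comp_assoc[OF h s l] by simp
    then have "k \<cdot> (r \<cdot> h) = h" using sh Comp_Zero[OF l XO] Add_Zero[OF krh] by simp
    moreover have "u = r \<cdot> h" if "u \<in> Hom C X Y" "k \<cdot> u = h" for u
      using Comp_assoc[OF that(1) k r] that(2) id(1) ident_Comp[OF that(1)] by simp
    ultimately show "\<exists>!u. u \<in> Hom C X Y \<and> k \<cdot> u = h" using rh by blast
  qed
  have x1: "(k, s) \<in> extensions C T Y" "(j, b) \<in> extensions C T Y"
    using short_exactI[OF s kerk es] short_exactI[OF b kerj eb] k s j(1) b
    unfolding extensions_def Hom_def by auto
  have "((j, b), (j, b)) \<in> ext_equiv C T Y"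
    using x1(2) ident_Hom[of E] iso_ident[of E] ident_Comp[OF j(1)] Comp_ident[OF b] Hom_Obj[OF b]
      Hom_src_tgt[OF j(1)]
    unfolding ext_equiv_def by auto
  moreover obtain \<xi> where "extensions C T Y // ext_equiv C T Y = {\<xi>}"
    using ext unfolding Ext1_zero_def Ext1_def Y_def[symmetric] by (rule is_singletonE)
  then have "ext_equiv C T Y `` {(k, s)} = ext_equiv C T Y `` {(j, b)}"
    using quotientI[OF x1(1), of "ext_equiv C T Y"] quotientI[OF x1(2), of "ext_equiv C T Y"]
    by simp
  ultimately have "((k, s), (j, b)) \<in> ext_equiv C T Y" by blast
  then obtain h where h: "h \<in> Hom C M E" "b \<cdot> h = s"
    using Hom_src_tgt[OF k] Hom_src_tgt[OF j(1)] unfolding ext_equiv_def by auto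
  \<comment> \<open>\<open>h \<cdot> l\<close> is a section of the pulled back extension, and \<open>a\<close> carries it to \<open>A\<close>.\<close>
  have hl: "h \<cdot> l \<in> Hom C T E" using Comp_Hom[OF l h(1)] .
  have "b \<cdot> (h \<cdot> l) = ident C T" using Comp_assoc[OF l h(1) b] h(2) id(2) by simp
  then have "p \<cdot> (a \<cdot> (h \<cdot> l)) = g"
    using Comp_assoc[OF hl a p] Comp_assoc[OF hl b g] ab Comp_ident[OF g] by simp
  then show ?thesis using Comp_Hom[OF hl a] by blast
qed

section \<open>Quotients of objects of a subcategory\<close>

text \<open>
  An object is the direct sum of a single copy of itself. So the vanishing of \<open>Ext\<^sup>1\<close> on quotients of
  finite direct sums covers all of \<open>Fac \<T>\<close>.
\<close>

lemma Fac_subset_Fac_obj: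
  assumes "A \<in> Obj C"
  shows "Fac C {A} \<subseteq> Fac_obj C A"
proof -
  have "is_direct_sum C 1 (\<lambda>_. A) A (\<lambda>_. ident C A)"
    using assms ident_Hom[OF assms] Comp_ident unfolding is_direct_sum_def by auto
  then show ?thesis unfolding Fac_obj_def Fac_def by blast
qed

text \<open>
  If \<open>p\<close> kills one right approximation \<open>f\<close>, it kills every morphism from \<open>S\<close> to \<open>A\<close>, and then every
  morphism from \<open>Fac S\<close>, as the latter can be tested after an epimorphism from an object of \<open>S\<close>.
\<close>

lemma Fac_factor_kernel:
  assumes p: "p \<in> Hom C A Q" and ker: "is_kernel C m p"
    and f: "f \<in> Hom C T\<^sub>0 A" "right_approx C S A f" and pf: "p \<cdot> f = Zero C T\<^sub>0 Q"
    and X: "X \<in> Fac C S" and g: "g \<in> Hom C X A"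
  shows "\<exists>h\<in>Hom C X (src C m). m \<cdot> h = g"
proof -
  obtain T t where T: "T \<in> S" and t: "t \<in> Hom C T X" "epi_mor C t" using X unfolding Fac_def by blast
  have "g \<cdot> t \<in> Hom C T A" using Comp_Hom[OF t(1) g] .
  then obtain h where h: "h \<in> Hom C T T\<^sub>0" "f \<cdot> h = g \<cdot> t"
    using f T Hom_src_tgt[OF f(1)] unfolding right_approx_def by metis
  have "(p \<cdot> g) \<cdot> t = (p \<cdot> f) \<cdot> h"
    using Comp_assoc[OF t(1) g p] Comp_assoc[OF h(1) f(1) p] h by simp
  then have "(p \<cdot> g) \<cdot> t = Zero C T Q" using pf Zero_Comp[OF h(1)] Hom_Obj[OF p] by simp
  then have "p \<cdot> g = Zero C X Q" using epi_cancel_Zero[OF t(2,1) Comp_Hom[OF g p]] by blast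
  then show ?thesis using kernel_factor[OF ker p g] by blast
qed

text \<open>
  \<open>m\<close> is the image of a right \<open>S\<close>-approximation and \<open>p\<close> its cokernel. The pair is kept together
  because it serves twice: \<open>m\<close> alone shows contravariant finiteness, while the whole short exact
  sequence is the candidate for the canonical sequence of a torsion pair.
\<close>

lemma right_approx_image:
  assumes S: "contravariantly_finite C S" and A: "A \<in> Obj C"
  obtains m p Q where "m \<in> Hom C (src C m) A" "p \<in> Hom C A Q" "is_kernel C m p" "epi_mor C p"
    "src C m \<in> Fac C S" "right_approx C (Fac C S) A m"
proof -
  obtain f where f: "right_approx C S A f" using S A unfolding contravariantly_finite_def by blast
  then have fH: "f \<in> Hom C (src C f) A" and fS: "src C f \<in> S"
    unfolding right_approx_def by (auto simp: Hom_def)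
  obtain m I e c where m: "m \<in> Hom C I A" and e: "e \<in> Hom C (src C f) I"
    and c: "c \<in> Hom C A (tgt C c)" and fme: "f = m \<cdot> e" and ee: "epi_mor C e" and ec: "epi_mor C c"
    and ker: "is_kernel C m c"
    using image_factorization[OF fH] .
  have I: "src C m = I" using Hom_src_tgt[OF m] by blast
  have IF: "I \<in> Fac C S" using fS e ee Hom_Obj[OF e] unfolding Fac_def by blast
  have "c \<cdot> f = Zero C (src C f) (tgt C c)"
    using Comp_assoc[OF e m c] fme kernel_Comp[OF ker c] I Zero_Comp[OF e] Hom_Obj[OF c] by simp
  then have "right_approx C (Fac C S) A m"
    using Fac_factor_kernel[OF c ker fH f] IF I Hom_src_tgt[OF m] unfolding right_approx_def by blast
  then show thesis using that[of m c] m c ker ec IF I by blast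
qed

lemma contravariantly_finite_Fac:
  "contravariantly_finite C S \<Longrightarrow> contravariantly_finite C (Fac C S)"
  using right_approx_image unfolding contravariantly_finite_def by metis

text \<open>
  The torsion-free class can only be the right orthogonal \<open>F\<close> of \<open>Fac S\<close>. That the cokernel \<open>Q\<close> of
  the image of the approximation lies in \<open>F\<close> is where the vanishing of \<open>Ext\<^sup>1\<close> enters: morphisms
  from \<open>S\<close> to \<open>Q\<close> lift to \<open>A\<close>, hence factor through the image and become zero in \<open>Q\<close>.
\<close>

lemma torsion_class_Fac:
  assumes S: "contravariantly_finite C S"
    and ext: "\<And>T Y. T \<in> S \<Longrightarrow> Y \<in> Fac C S \<Longrightarrow> Ext1_zero C T Y"
  shows "torsion_class C (Fac C S)"
proof -
  define F where "F = {Y \<in> Obj C. \<forall>D\<in>Fac C S. Hom C D Y = {Zero C D Y}}"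
  have "tgt C f \<in> F" if iso: "iso_mor C f" and "src C f \<in> F" for f
  proof -
    let ?A = "src C f" and ?B = "tgt C f"
    obtain f' where f: "f \<in> Hom C ?A ?B" and f': "f' \<in> Hom C ?B ?A" and ff': "f \<cdot> f' = ident C ?B"
      using iso unfolding iso_mor_def by (auto simp: Hom_def)
    have "u = Zero C D ?B" if D: "D \<in> Fac C S" and u: "u \<in> Hom C D ?B" for D u
    proof -
      have "f' \<cdot> u = Zero C D ?A"
        using \<open>?A \<in> F\<close> D Comp_Hom[OF u f'] unfolding F_def by blast
      then show ?thesis
        using Comp_assoc[OF u f' f] ff' ident_Comp[OF u] Comp_Zero[OF f] Hom_Obj[OF u] by simp
    qed
    then show ?thesis
      using Zero_Hom Hom_Obj[OF f] unfolding F_def Fac_def by blast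
  qed
  then have "full_subcat C F" unfolding full_subcat_def F_def by blast
  moreover have "\<exists>i p. short_exact C i p \<and> tgt C i = A \<and> src C i \<in> Fac C S \<and> tgt C p \<in> F"
    if A: "A \<in> Obj C" for A
  proof -
    obtain m p Q where m: "m \<in> Hom C (src C m) A" and p: "p \<in> Hom C A Q" and ker: "is_kernel C m p"
      and ep: "epi_mor C p" and mF: "src C m \<in> Fac C S" and app: "right_approx C (Fac C S) A m"
      using right_approx_image[OF S A] .
    have QO: "Q \<in> Obj C" using Hom_Obj[OF p] by blast
    have "g = Zero C D Q" if D: "D \<in> Fac C S" and g: "g \<in> Hom C D Q" for D g
    proof -
      obtain T t where T: "T \<in> S" and t: "t \<in> Hom C T D" "epi_mor C t"
        using D unfolding Fac_def by blast
      have TF: "T \<in> Fac C S"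
        using T ident_Hom[of T] iso_epi[OF iso_ident[of T]] Hom_Obj[OF t(1)] unfolding Fac_def by blast
      obtain l where l: "l \<in> Hom C T A" "p \<cdot> l = g \<cdot> t"
        using Ext1_zero_lift[OF ext[OF T mF] p ker ep Comp_Hom[OF t(1) g]] by blast
      obtain h where h: "h \<in> Hom C T (src C m)" "m \<cdot> h = l"
        using app TF l(1) unfolding right_approx_def by blast
      have "g \<cdot> t = Zero C T Q"
        using Comp_assoc[OF h(1) m p] h(2) l(2) kernel_Comp[OF ker p] Zero_Comp[OF h(1) QO] by simp
      then show ?thesis using epi_cancel_Zero[OF t(2,1) g] by blast
    qed
    then have "Q \<in> F" using QO Zero_Hom unfolding F_def Fac_def by blast
    then show ?thesis
      using short_exactI[OF p ker ep] Hom_src_tgt[OF m] Hom_src_tgt[OF p] mF by blast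
  qed
  ultimately have "torsion_pair C (Fac C S) F"
    using full_subcat_Fac unfolding torsion_pair_def F_def by blast
  then show ?thesis unfolding torsion_class_def by blast
qed

text \<open>
  Left approximations of projectives suffice: a pushout along an epimorphism \<open>P \<rightarrow> A\<close> transports one
  from \<open>P\<close> to \<open>A\<close>. Projectivity of \<open>P\<close> is what allows targets in \<open>Fac S\<close> instead of \<open>S\<close>.
\<close>

lemma covariantly_finite_Fac:
  assumes enough: "enough_projectives C"
    and approx: "\<And>P. projective C P \<Longrightarrow> \<exists>f. left_approx C S P f"
  shows "covariantly_finite C (Fac C S)"
proof -
  have "\<exists>d. left_approx C (Fac C S) A d" if A: "A \<in> Obj C" for A
  proof -
    obtain P p where P: "projective C P" and p: "p \<in> Hom C P A" "epi_mor C p"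
      using enough A unfolding enough_projectives_def by blast
    obtain f where f: "left_approx C S P f" using approx[OF P] by blast
    define T where "T = tgt C f"
    have fH: "f \<in> Hom C P T" and T: "T \<in> S"
      using f unfolding left_approx_def T_def by (auto simp: Hom_def)
    obtain b B d where b: "b \<in> Hom C T B" and d: "d \<in> Hom C A B" and "b \<cdot> f = d \<cdot> p"
      and eb: "epi_mor C b" and univ[rule_format]: "\<forall>X. \<forall>x\<in>Hom C T X. \<forall>y\<in>Hom C A X. x \<cdot> f = y \<cdot> p \<longrightarrow>
        (\<exists>!u. u \<in> Hom C B X \<and> u \<cdot> b = x \<and> u \<cdot> d = y)"
      using ex_pushout_epi[OF fH p] .
    have "\<exists>h\<in>Hom C B X. h \<cdot> d = y" if X: "X \<in> Fac C S" and y: "y \<in> Hom C A X" for X y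
    proof -
      obtain V v where V: "V \<in> S" and v: "v \<in> Hom C V X" "epi_mor C v"
        using X unfolding Fac_def by blast
      obtain w where w: "w \<in> Hom C P V" "v \<cdot> w = y \<cdot> p"
        using P v(2) Comp_Hom[OF p(1) y] Hom_src_tgt[OF v(1)] unfolding projective_def by auto
      obtain z where z: "z \<in> Hom C T V" "z \<cdot> f = w"
        using f V w(1) unfolding left_approx_def T_def by blast
      have "(v \<cdot> z) \<cdot> f = y \<cdot> p" using Comp_assoc[OF fH z(1) v(1)] z w by simp
      then show ?thesis using univ[OF Comp_Hom[OF z(1) v(1)] y] by blast
    qed
    moreover have "B \<in> Fac C S" using T b eb Hom_Obj[OF b] unfolding Fac_def by blast
    ultimately have "left_approx C (Fac C S) A d"
      using Hom_src_tgt[OF d] unfolding left_approx_def by blast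
    then show ?thesis by blast
  qed
  then show ?thesis unfolding covariantly_finite_def by blast
qed

end

theorem corollary1p4:
  fixes C :: "('o, 'm) precat" and \<T> :: "'o set"
  assumes "abelian_category C"
    and "enough_projectives C"
    and "support_tau_tilting C \<T>"
  shows "functorially_finite C (Fac C \<T>) \<and> torsion_class C (Fac C \<T>)"
proof -
  interpret abelian_category C by fact
  have SO: "\<T> \<subseteq> Obj C" and cf: "contravariantly_finite C \<T>"
    and ext: "\<And>T\<^sub>1 T\<^sub>2 Y. T\<^sub>1 \<in> \<T> \<Longrightarrow> T\<^sub>2 \<in> \<T> \<Longrightarrow> Y \<in> Fac_obj C T\<^sub>2 \<Longrightarrow> Ext1_zero C T\<^sub>1 Y"
    and approx: "\<And>P. projective C P \<Longrightarrow> \<exists>f. left_approx C \<T> P f"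
    using assms(3) unfolding support_tau_tilting_def additive_subcat_def full_subcat_def by blast+
  have "Ext1_zero C T Y" if T: "T \<in> \<T>" and Y: "Y \<in> Fac C \<T>" for T Y
  proof -
    obtain T' where "T' \<in> \<T>" "Y \<in> Fac C {T'}" using Y unfolding Fac_def by blast
    then show ?thesis using ext[OF T] Fac_subset_Fac_obj SO by blast
  qed
  then show ?thesis
    using torsion_class_Fac[OF cf] contravariantly_finite_Fac[OF cf]
      covariantly_finite_Fac[OF assms(2) approx] unfolding functorially_finite_def by blast
qed

end
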